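(* Let $a_0,\dots,a_5\in\mathbb{C}$ and let $$F(s,x_1,x_2)=\det\begin{pmatrix}0&1&\frac{x_1+x_2}{2}&x_1x_2\\ 1&a_0&a_1&a_5-2s\\ \frac{x_1+x_2}{2}&a_1&a_2+s&a_3\\ x_1x_2&a_5-2s&a_3&a_4\end{pmatrix}$$ be the general pencil polynomial, with $\mathcal D_s(F)(x_1,x_2)=P(x_1)P(x_2)$ and $\mathcal D_{x_2}(F)(s,x_1)=J(s)P(x_1)$, where $P$ is a quartic and $J$ a cubic polynomial, and suppose that $P$ has four distinct zeros. Let $t^2=J'(m)=4m^3-g_2m-g_3$ be a canonical (Weierstrass) form of the elliptic curve $\Gamma_2:\ t^2=J(s)$. Then there exist a fractional-linear transformation $\hat\psi$, mapping the three zeros of $J'$ and $\infty$ to the four zeros of $P$, and an affine change of parameter $s=\gamma(m)$, such that the equation $$F(\gamma(m),\hat\psi(x),\hat\psi(y))=0$$ (after clearing denominators) defines the two-valued coset group structure $(\Gamma_2,\mathbb{Z}_2)$ on $\mathbb{CP}^1$: for $m\neq x$ in $\mathbb{C}$, the two solutions $y$ of this equation, counted with multiplicity, are exactly the two elements of $$m*_cx=\left[-m-x+\left(\frac{n-u}{2(m-x)}\right)^2,\ -m-x+\left(\frac{n+u}{2(m-x)}\right)^2\right],\qquad n^2=J'(m),\ u^2=J'(x).$$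
   Context: $\mathcal D_y$ denotes the discriminant with respect to the variable $y$ ($b^2-4ac$ for $ay^2+by+c$). The two-valued coset group $(\Gamma_2,\mathbb Z_2)$ is $\mathbb{CP}^1=\Gamma_2/\{\pm1\}$, where $\Gamma_2:\ t^2=4m^3-g_2m-g_3$ is the elliptic curve with its group law (unit at infinity) and $\mathbb Z_2$ acts by $(m,t)\mapsto(m,-t)$; its two-valued operation sends the classes of points $A,B\in\Gamma_2$ to the unordered pair of classes of $A+B$ and $A-B$. In terms of the coordinate $m$ on $\mathbb{CP}^1$ this is the displayed operation $*_c$ for distinct finite arguments. *)

theory Defs
  imports "HOL-Analysis.Analysis" "HOL-Computational_Algebra.Polynomial"
begin

section \<open>Polynomial functions of one variable and their discriminant\<close>

text \<open>The polynomial inducing a given polynomial function; it is unique because the field is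
  infinite. The value is unspecified if the function is not polynomial.\<close>

definition poly_of_fun :: "(complex \<Rightarrow> complex) \<Rightarrow> complex poly" where
  "poly_of_fun f = (THE p. poly p = f)"

lemma poly_of_fun_poly [simp]: "poly_of_fun (poly p) = p"
  unfolding poly_of_fun_def by (rule the_equality) (simp_all add: poly_eq_poly_eq_iff)

lemma poly_of_fun_eqI: "(\<And>y. f y = poly p y) \<Longrightarrow> poly_of_fun f = p"
  using poly_of_fun_poly[of p] by (metis ext)

definition quadratic_discriminant :: "(complex \<Rightarrow> complex) \<Rightarrow> complex" where
  "quadratic_discriminant f =
     (let p = poly_of_fun f in (coeff p 1)\<^sup>2 - 4 * coeff p 2 * coeff p 0)"

lemma quadratic_discriminant_quadratic:
  "quadratic_discriminant (\<lambda>y. a * y\<^sup>2 + b * y + c) = b\<^sup>2 - 4 * a * c"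
proof -
  have "poly_of_fun (\<lambda>y. a * y\<^sup>2 + b * y + c) = [:c, b, a:]"
    by (rule poly_of_fun_eqI) (simp add: algebra_simps power2_eq_square)
  then show ?thesis
    by (simp add: quadratic_discriminant_def Let_def numeral_2_eq_2)
qed

section \<open>The pencil polynomial\<close>

definition pencil :: "(nat \<Rightarrow> complex) \<Rightarrow> complex \<Rightarrow> complex \<Rightarrow> complex \<Rightarrow> complex" where
  "pencil a s x1 x2 = det (vector
     [vector [0,             1,             (x1 + x2) / 2, x1 * x2],
      vector [1,             a 0,           a 1,           a 5 - 2 * s],
      vector [(x1 + x2) / 2, a 1,           a 2 + s,       a 3],
      vector [x1 * x2,       a 5 - 2 * s,   a 3,           a 4]] :: complex^4^4)"

text \<open>The trihomogeneous form of the pencil polynomial, of degree 2 in each of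
  \<open>(S : W)\<close>, \<open>(X1 : Z1)\<close>, \<open>(X2 : Z2)\<close>: the border of the matrix is multiplied by \<open>Z1 * Z2\<close> and
  the 3 by 3 block by \<open>W\<close>. This is how denominators are cleared; see \<open>pencil_hom_eq\<close> below.\<close>

definition pencil_hom ::
  "(nat \<Rightarrow> complex) \<Rightarrow> complex \<Rightarrow> complex \<Rightarrow> complex \<Rightarrow> complex \<Rightarrow> complex \<Rightarrow> complex \<Rightarrow> complex" where
  "pencil_hom a S W X1 Z1 X2 Z2 =
     (let h = (X1 * Z2 + X2 * Z1) / 2 in
      det (vector
       [vector [0,       Z1 * Z2,         h,           X1 * X2],
        vector [Z1 * Z2, a 0 * W,         a 1 * W,     a 5 * W - 2 * S],
        vector [h,       a 1 * W,         a 2 * W + S, a 3 * W],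
        vector [X1 * X2, a 5 * W - 2 * S, a 3 * W,     a 4 * W]] :: complex^4^4))"

lemma pencil_hom_one: "pencil_hom a s 1 x1 1 x2 1 = pencil a s x1 x2"
  by (simp add: pencil_hom_def pencil_def Let_def)

lemma vector_4:
  "(vector [x,y,z,w] :: ('a::zero)^4) $ 1 = x"
  "(vector [x,y,z,w] :: ('a::zero)^4) $ 2 = y"
  "(vector [x,y,z,w] :: ('a::zero)^4) $ 3 = z"
  "(vector [x,y,z,w] :: ('a::zero)^4) $ 4 = w"
  unfolding vector_def by simp_all

lemma pencil_hom_eq:
  assumes "W \<noteq> 0" "Z1 \<noteq> 0" "Z2 \<noteq> 0"
  shows "pencil_hom a S W X1 Z1 X2 Z2
           = W\<^sup>2 * Z1\<^sup>2 * Z2\<^sup>2 * pencil a (S / W) (X1 / Z1) (X2 / Z2)"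
proof -
  define h where "h = (X1 / Z1 + X2 / Z2) / 2"
  define c :: "complex^4" where "c = vector [Z1 * Z2 / W, 1, 1, 1]"
  define d :: "complex^4" where "d = vector [Z1 * Z2, W, W, W]"
  define B :: "complex^4^4" where "B = vector
     [vector [0,                   1,                   h,           X1 / Z1 * (X2 / Z2)],
      vector [1,                   a 0,                 a 1,         a 5 - 2 * (S / W)],
      vector [h,                   a 1,                 a 2 + S / W, a 3],
      vector [X1 / Z1 * (X2 / Z2), a 5 - 2 * (S / W),   a 3,         a 4]]"
  define C :: "complex^4^4" where "C = (\<chi> i j. c $ j * B $ i $ j)"
  have prod4: "prod f (UNIV :: 4 set) = f 1 * f 2 * f 3 * f 4" for f :: "4 \<Rightarrow> complex"
    unfolding UNIV_4 by (simp add: ac_simps)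
  have 1: "det (\<chi> i. d $ i *s C $ i) = prod (\<lambda>i. d $ i) UNIV * det C"
    using det_rows_mul[of "\<lambda>i. d $ i" "\<lambda>i. C $ i"] by simp
  have "transpose C = (\<chi> i. c $ i *s transpose B $ i)"
    by (simp add: C_def transpose_def vec_eq_iff)
  then have "det C = det (\<chi> i. c $ i *s transpose B $ i)"
    by (metis det_transpose)
  also have "\<dots> = prod (\<lambda>i. c $ i) UNIV * det B"
    using det_rows_mul[of "\<lambda>i. c $ i" "\<lambda>i. transpose B $ i"] by simp
  finally have 2: "det C = prod (\<lambda>i. c $ i) UNIV * det B" .
  have hh: "(X1 * Z2 + X2 * Z1) / 2 = Z1 * Z2 * h"
    using assms by (simp add: h_def field_simps)
  have m: "vector
       [vector [0,            Z1 * Z2,         Z1 * Z2 * h, X1 * X2],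
        vector [Z1 * Z2,      a 0 * W,         a 1 * W,     a 5 * W - 2 * S],
        vector [Z1 * Z2 * h,  a 1 * W,         a 2 * W + S, a 3 * W],
        vector [X1 * X2,      a 5 * W - 2 * S, a 3 * W,     a 4 * W]]
     = (\<chi> i. d $ i *s C $ i)"
    using assms
    by (simp add: vec_eq_iff forall_4 vector_4 C_def B_def c_def d_def right_diff_distrib
        distrib_left)
  have p: "pencil a (S / W) (X1 / Z1) (X2 / Z2) = det B"
    by (simp only: pencil_def B_def h_def)
  have "prod (\<lambda>i. d $ i) UNIV * prod (\<lambda>i. c $ i) UNIV = W\<^sup>2 * Z1\<^sup>2 * Z2\<^sup>2"
    using assms by (simp add: prod4 c_def d_def vector_4 power2_eq_square)
  then show ?thesis
    unfolding pencil_hom_def Let_def hh m 1 2 p by (simp only: mult.assoc[symmetric])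
qed

text \<open>The result of substituting \<open>s = \<alpha> m + \<beta>\<close>, \<open>x1 = \<psi>(x)\<close>, \<open>x2 = \<psi>(y)\<close> with
  \<open>\<psi>(z) = (p z + q) / (r z + t)\<close> in the pencil polynomial and clearing denominators, written in
  homogeneous coordinates \<open>(M : W)\<close>, \<open>(X : Z)\<close>, \<open>(Y : V)\<close> of \<open>m\<close>, \<open>x\<close>, \<open>y\<close>.\<close>

definition pencil_pullback ::
  "(nat \<Rightarrow> complex) \<Rightarrow> complex \<Rightarrow> complex \<Rightarrow> complex \<Rightarrow> complex \<Rightarrow> complex \<Rightarrow> complex \<Rightarrow>
   complex \<Rightarrow> complex \<Rightarrow> complex \<Rightarrow> complex \<Rightarrow> complex \<Rightarrow> complex \<Rightarrow> complex" where
  "pencil_pullback a \<alpha> \<beta> p q r t M W X Z Y V =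
     pencil_hom a (\<alpha> * M + \<beta> * W) W (p * X + q * Z) (r * X + t * Z) (p * Y + q * V) (r * Y + t * V)"

lemma pencil_pullback_affine:
  assumes "r * x + t \<noteq> 0" "r * y + t \<noteq> 0"
  shows "pencil_pullback a \<alpha> \<beta> p q r t m 1 x 1 y 1 =
    (r * x + t)\<^sup>2 * (r * y + t)\<^sup>2 * pencil a (\<alpha> * m + \<beta>) (moebius p q r t x) (moebius p q r t y)"
  using assms by (simp add: pencil_pullback_def pencil_hom_eq moebius_def)

section \<open>The projective line\<close>

text \<open>\<open>None\<close> is the point at infinity.\<close>

type_synonym cp1 = "complex option"

fun cp1_num :: "cp1 \<Rightarrow> complex" where
  "cp1_num None = 1"
| "cp1_num (Some z) = z"

fun cp1_den :: "cp1 \<Rightarrow> complex" where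
  "cp1_den None = 0"
| "cp1_den (Some z) = 1"

fun moebius_cp1 :: "complex \<Rightarrow> complex \<Rightarrow> complex \<Rightarrow> complex \<Rightarrow> cp1 \<Rightarrow> cp1" where
  "moebius_cp1 p q r t None = (if r = 0 then None else Some (p / r))"
| "moebius_cp1 p q r t (Some z) =
     (if r * z + t = 0 then None else Some (moebius p q r t z))"

text \<open>The binary form \<open>Q\<close> in \<open>(Y : V)\<close> is not identically zero and its zeros on the projective
  line, with multiplicity, form the multiset \<open>R\<close>.\<close>

definition has_cp1_roots :: "(complex \<Rightarrow> complex \<Rightarrow> complex) \<Rightarrow> cp1 multiset \<Rightarrow> bool" where
  "has_cp1_roots Q R \<longleftrightarrow>
     (\<exists>k. k \<noteq> 0 \<and> (\<forall>Y V. Q Y V = k * (\<Prod>p\<in>#R. Y * cp1_den p - V * cp1_num p)))"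

section \<open>Weierstrass curves and the two-valued coset group\<close>

definition weierstrass_cubic :: "complex \<Rightarrow> complex \<Rightarrow> complex \<Rightarrow> complex" where
  "weierstrass_cubic g2 g3 m = 4 * m ^ 3 - g2 * m - g3"

text \<open>The map \<open>(m, t) \<mapsto> (\<alpha> m + \<beta>, \<mu> t)\<close> is an isomorphism from \<open>t\<^sup>2 = 4 m\<^sup>3 - g2 m - g3\<close>
  to \<open>t\<^sup>2 = J(s)\<close>; every isomorphism preserving the points at infinity is of this form.\<close>

definition weierstrass_form_of :: "complex poly \<Rightarrow> complex \<Rightarrow> complex \<Rightarrow> bool" where
  "weierstrass_form_of J g2 g3 \<longleftrightarrow>
     (\<exists>\<alpha> \<beta> \<mu>. \<alpha> \<noteq> 0 \<and> \<mu> \<noteq> 0 \<and>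
        (\<forall>m. poly J (\<alpha> * m + \<beta>) = \<mu>\<^sup>2 * weierstrass_cubic g2 g3 m))"

type_synonym curve_point = "(complex \<times> complex) option"

definition weierstrass_curve :: "complex \<Rightarrow> complex \<Rightarrow> curve_point set" where
  "weierstrass_curve g2 g3 = insert None (Some ` {(m, t). t\<^sup>2 = weierstrass_cubic g2 g3 m})"

fun curve_neg :: "curve_point \<Rightarrow> curve_point" where
  "curve_neg None = None"
| "curve_neg (Some (m, t)) = Some (m, - t)"

text \<open>The chord--tangent law: a line of slope \<open>l\<close> meets the curve in three points whose
  \<open>m\<close>-coordinates sum to \<open>l\<^sup>2 / 4\<close>. The constant \<open>g3\<close> does not occur in the formulas.\<close>

fun curve_add :: "complex \<Rightarrow> curve_point \<Rightarrow> curve_point \<Rightarrow> curve_point" where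
  "curve_add g2 None B = B"
| "curve_add g2 A None = A"
| "curve_add g2 (Some (m1, t1)) (Some (m2, t2)) =
     (if m1 = m2 \<and> t1 = - t2 then None
      else let l = (if m1 = m2 then (12 * m1\<^sup>2 - g2) / (2 * t1) else (t1 - t2) / (m1 - m2));
               m3 = l\<^sup>2 / 4 - m1 - m2
           in Some (m3, - (t1 + l * (m3 - m1))))"

text \<open>The quotient map of the curve by \<open>(m, t) \<mapsto> (m, - t)\<close>.\<close>

definition curve_class :: "curve_point \<Rightarrow> cp1" where
  "curve_class = map_option fst"

text \<open>The two-valued product of the classes of \<open>A\<close> and \<open>B\<close>, as an unordered pair.\<close>

definition coset_product :: "complex \<Rightarrow> curve_point \<Rightarrow> curve_point \<Rightarrow> cp1 multiset" where
  "coset_product g2 A B =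
     {# curve_class (curve_add g2 A B), curve_class (curve_add g2 A (curve_neg B)) #}"

text \<open>For all classes \<open>m\<close>, \<open>x\<close> in the projective line, the zeros \<open>y\<close> of the trihomogeneous form
  \<open>G(m, x, y)\<close> are the two values of the product of \<open>m\<close> and \<open>x\<close>. Every class is represented by
  a point of the curve, so quantifying over \<open>A\<close> and \<open>B\<close> covers all \<open>m\<close> and \<open>x\<close>.\<close>

definition defines_coset_group ::
  "complex \<Rightarrow> complex \<Rightarrow>
   (complex \<Rightarrow> complex \<Rightarrow> complex \<Rightarrow> complex \<Rightarrow> complex \<Rightarrow> complex \<Rightarrow> complex) \<Rightarrow> bool" where
  "defines_coset_group g2 g3 G \<longleftrightarrow>
     (\<forall>A \<in> weierstrass_curve g2 g3. \<forall>B \<in> weierstrass_curve g2 g3.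
        let m = curve_class A; x = curve_class B in
        has_cp1_roots (G (cp1_num m) (cp1_den m) (cp1_num x) (cp1_den x)) (coset_product g2 A B))"

end

theory Submission
  imports Defs
begin

text \<open>
  Border and block of the determinant transform compatibly under fractional-linear changes of
  \<open>x1\<close>, \<open>x2\<close>: the border is the polarised square of \<open>(1, x)\<close>, the block is
  up to signs the symmetric 3 by 3 matrix of a binary quartic \<open>Q\<close>, and \<open>s\<close> multiplies the invariant
  form on binary quadratics. After a shift of \<open>s\<close> the pencil is therefore a covariant of \<open>Q\<close> alone, and it is
  enough to compute it for one normal form of \<open>Q\<close>. If \<open>Q\<close> is itself a Weierstrass cubic,
  seen as a quartic with one zero at infinity, the pencil is the form
  \<open>(m x + m y + x y + g2 / 4)\<^sup>2 - (m + x + y) (4 m x y - g3)\<close>, whose vanishing is the collinearity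
  condition for points of the curve over \<open>m\<close>, \<open>x\<close>, \<open>y\<close>, i.e. the addition law up to signs.

  Two discriminants connect the hypotheses with \<open>Q\<close>. Restricting the discriminant in \<open>s\<close> to the
  diagonal gives \<open>P = Q\<close> or \<open>P = - Q\<close> (\<open>centred_pencil_quadratic_s\<close>). The discriminant in \<open>x2\<close> is
  \<open>Q(x1)\<close> times the Weierstrass cubic formed with the classical invariants of \<open>Q\<close>
  (\<open>centred_pencil_discriminant\<close>). So \<open>J\<close> is this cubic up to sign and shift, and any
  Weierstrass form of \<open>J\<close> has the invariants of \<open>Q\<close>, rescaled
  (\<open>weierstrass_forms_proportional\<close>).

  The reduction to the normal form uses a zero \<open>e\<close> of \<open>Q\<close>: translate it to the origin and invert
  (\<open>centred_pencil_normal_form\<close>). It is nondegenerate because \<open>e\<close> is simple. Finally the roots of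
  the coset form are compared with the chord--tangent law (\<open>coset_form_roots\<close>), including the
  points at infinity; a point of order two added to itself is where the simplicity of the zeros of
  the cubic enters, and this is inherited from \<open>P\<close> through the fractional-linear map
  (\<open>moebius_cp1_image_roots\<close>).
\<close>

section \<open>Determinant expansion and centring of the parameter\<close>

text \<open>The coefficients carry binomial weights, in which the classical invariants
  of binary quartics take their usual shape.\<close>

definition quartic_form :: "complex \<Rightarrow> complex \<Rightarrow> complex \<Rightarrow> complex \<Rightarrow> complex \<Rightarrow> complex \<Rightarrow> complex \<Rightarrow> complex" where
  "quartic_form A0 A1 A2 A3 A4 X Z =
     A0 * X^4 + 4 * A1 * X^3 * Z + 6 * A2 * X\<^sup>2 * Z\<^sup>2 + 4 * A3 * X * Z^3 + A4 * Z^4"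

text \<open>The pencil polynomial in a parameter chosen so that the cubic \<open>J\<close> has no quadratic term. In
  this parameter it depends only on the quartic with coefficients \<open>A0, ..., A4\<close>: the coefficients
  \<open>a 2\<close> and \<open>a 5\<close> enter separately only through a shift of \<open>s\<close>, because
  \<open>(a 2, a 5) \<mapsto> (a 2 + \<delta>, a 5 - 2 \<delta>)\<close> is the same as \<open>s \<mapsto> s + \<delta>\<close>. The entries \<open>c\<close> and \<open>d\<close> are the
  two matrix entries that contain \<open>s\<close>.\<close>

definition centred_pencil :: "complex \<Rightarrow> complex \<Rightarrow> complex \<Rightarrow> complex \<Rightarrow> complex \<Rightarrow>
   complex \<Rightarrow> complex \<Rightarrow> complex \<Rightarrow> complex \<Rightarrow> complex \<Rightarrow> complex \<Rightarrow> complex" where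
  "centred_pencil A0 A1 A2 A3 A4 S W X1 Z1 X2 Z2 =
     (let u = Z1 * Z2; h = (X1 * Z2 + X2 * Z1) / 2; w = X1 * X2;
          c = A2 * W - 2 * S; d = A2 * W + S
      in u\<^sup>2 * (A3\<^sup>2 * W\<^sup>2 - A4 * W * d) + 2 * u * h * (A3 * W * c - A1 * A4 * W\<^sup>2)
       + 2 * u * w * (c * d - A1 * A3 * W\<^sup>2) + h\<^sup>2 * (c\<^sup>2 - A0 * A4 * W\<^sup>2)
       + 2 * h * w * (A1 * W * c - A0 * A3 * W\<^sup>2) + w\<^sup>2 * (A1\<^sup>2 * W\<^sup>2 - A0 * W * d))"

lemma det_4:
  fixes M :: "complex^4^4"
  shows "det M =
     M$1$1 * (M$2$2 * (M$3$3 * M$4$4 - M$3$4 * M$4$3) - M$2$3 * (M$3$2 * M$4$4 - M$3$4 * M$4$2) + M$2$4 * (M$3$2 * M$4$3 - M$3$3 * M$4$2))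
   - M$1$2 * (M$2$1 * (M$3$3 * M$4$4 - M$3$4 * M$4$3) - M$2$3 * (M$3$1 * M$4$4 - M$3$4 * M$4$1) + M$2$4 * (M$3$1 * M$4$3 - M$3$3 * M$4$1))
   + M$1$3 * (M$2$1 * (M$3$2 * M$4$4 - M$3$4 * M$4$2) - M$2$2 * (M$3$1 * M$4$4 - M$3$4 * M$4$1) + M$2$4 * (M$3$1 * M$4$2 - M$3$2 * M$4$1))
   - M$1$4 * (M$2$1 * (M$3$2 * M$4$3 - M$3$3 * M$4$2) - M$2$2 * (M$3$1 * M$4$3 - M$3$3 * M$4$1) + M$2$3 * (M$3$1 * M$4$2 - M$3$2 * M$4$1))"
proof -
  have f: "finite {2::4, 3, 4}" "1 \<notin> {2::4, 3, 4}" "finite {3::4, 4}" "2 \<notin> {3::4, 4}"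
     "finite {4::4}" "3 \<notin> {4::4}" by auto
  show ?thesis
    unfolding det_def UNIV_4
    unfolding sum_over_permutations_insert[OF f(1,2)]
    unfolding sum_over_permutations_insert[OF f(3,4)]
    unfolding sum_over_permutations_insert[OF f(5,6)]
    unfolding permutes_sing
    by (simp add: sign_swap_id permutation_swap_id permutation_compose sign_compose sign_id
        transpose_eq_iff Transposition.transpose_def algebra_simps)
qed

text \<open>A bordered symmetric determinant is minus the adjugate of the block, evaluated as a quadratic
  form at the border.\<close>

lemma det_bordered:
  fixes u h w a0 a1 c d a3 a4 :: complex
  shows "det (vector [vector [0, u, h, w], vector [u, a0, a1, c], vector [h, a1, d, a3],
           vector [w, c, a3, a4]] :: complex^4^4) =
         u\<^sup>2 * (a3\<^sup>2 - a4 * d) + 2 * u * h * (a1 * a4 - a3 * c) + 2 * u * w * (c * d - a1 * a3)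
       + h\<^sup>2 * (c\<^sup>2 - a0 * a4) + 2 * h * w * (a0 * a3 - a1 * c) + w\<^sup>2 * (a1\<^sup>2 - a0 * d)"
  unfolding det_4 vector_4 by algebra

text \<open>Only collects the powers of \<open>W\<close> and the signs of the odd coefficients; the entries stay
  abstract so that the normalisation is short.\<close>

lemma pencil_expansion_scale:
  fixes u h w a0 a1 c d a3 a4 :: complex
  shows "u\<^sup>2 * ((a3 * W)\<^sup>2 - a4 * W * d) + 2 * u * h * (a1 * W * (a4 * W) - a3 * W * c)
       + 2 * u * w * (c * d - a1 * W * (a3 * W)) + h\<^sup>2 * (c\<^sup>2 - a0 * W * (a4 * W))
       + 2 * h * w * (a0 * W * (a3 * W) - a1 * W * c) + w\<^sup>2 * ((a1 * W)\<^sup>2 - a0 * W * d) =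
   u\<^sup>2 * ((- a3)\<^sup>2 * W\<^sup>2 - a4 * W * d) + 2 * u * h * (- a3 * W * c - - a1 * a4 * W\<^sup>2)
       + 2 * u * w * (c * d - - a1 * - a3 * W\<^sup>2) + h\<^sup>2 * (c\<^sup>2 - a0 * a4 * W\<^sup>2)
       + 2 * h * w * (- a1 * W * c - a0 * - a3 * W\<^sup>2) + w\<^sup>2 * ((- a1)\<^sup>2 * W\<^sup>2 - a0 * W * d)"
  by algebra

text \<open>The shift \<open>\<delta> = a 2 - A2\<close> is determined by asking that
  \<open>a 2 + s = A2 + (s + \<delta>)\<close> and \<open>a 5 - 2 s = A2 - 2 (s + \<delta>)\<close> for the same \<open>A2\<close>.\<close>

lemma pencil_hom_eq_centred:
  fixes a :: "nat \<Rightarrow> complex"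
  defines "A2 \<equiv> (2 * a 2 + a 5) / 3"
  shows "pencil_hom a S W X1 Z1 X2 Z2 =
    centred_pencil (a 0) (- a 1) A2 (- a 3) (a 4) (S + (a 2 - A2) * W) W X1 Z1 X2 Z2"
proof -
  have c: "a 5 * W - 2 * S = A2 * W - 2 * (S + (a 2 - A2) * W)"
    by (simp add: A2_def field_simps)
  have d: "a 2 * W + S = A2 * W + (S + (a 2 - A2) * W)"
    by (simp add: algebra_simps)
  show ?thesis
    unfolding pencil_hom_def c d Let_def det_bordered centred_pencil_def
    by (rule pencil_expansion_scale)
qed

section \<open>Discriminants of the pencil and the invariants of the quartic\<close>

definition invariant_g2 :: "complex \<Rightarrow> complex \<Rightarrow> complex \<Rightarrow> complex \<Rightarrow> complex \<Rightarrow> complex" where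
  "invariant_g2 A0 A1 A2 A3 A4 = A0 * A4 - 4 * A1 * A3 + 3 * A2\<^sup>2"

definition invariant_g3 :: "complex \<Rightarrow> complex \<Rightarrow> complex \<Rightarrow> complex \<Rightarrow> complex \<Rightarrow> complex" where
  "invariant_g3 A0 A1 A2 A3 A4 =
     A0 * A2 * A4 + 2 * A1 * A2 * A3 - A2^3 - A0 * A3\<^sup>2 - A1\<^sup>2 * A4"

text \<open>The coefficient of \<open>s\<^sup>2\<close> in the pencil polynomial is \<open>(x1 - x2)\<^sup>2\<close>, so on the diagonal
  the polynomial is linear in \<open>s\<close>. Its discriminant there is the square of the quartic; this
  identifies \<open>P\<close> up to sign.\<close>

lemma centred_pencil_quadratic_s:
  "centred_pencil A0 A1 A2 A3 A4 s 1 x 1 x 1 = - quartic_form A0 A1 A2 A3 A4 x 1 * s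
    + centred_pencil A0 A1 A2 A3 A4 0 1 x 1 x 1"
  unfolding centred_pencil_def quartic_form_def Let_def by (simp add: field_simps; algebra)

text \<open>Sylvester's determinant identity in disguise: the discriminant in \<open>x2\<close> is a Gram determinant
  for the adjugate of the 3 by 3 block, hence divisible by the determinant of the block. That
  determinant is \<open>- (4 s\<^sup>3 - g2 s - g3)\<close> with the classical invariants of the quartic, so up to sign and
  shift \<open>J\<close> is the resolvent cubic of \<open>P\<close>.\<close>

lemma centred_pencil_discriminant:
  "quadratic_discriminant (\<lambda>y. centred_pencil A0 A1 A2 A3 A4 s 1 x 1 y 1) =
   weierstrass_cubic (invariant_g2 A0 A1 A2 A3 A4) (invariant_g3 A0 A1 A2 A3 A4) s
     * quartic_form A0 A1 A2 A3 A4 x 1"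
proof -
  define c d where "c = A2 - 2 * s" and "d = A2 + s"
  define k2 k1 k0 where
    "k2 = (c\<^sup>2 - A0 * A4) / 4 + x * (A1 * c - A0 * A3) + x\<^sup>2 * (A1\<^sup>2 - A0 * d)" and
    "k1 = (A3 * c - A1 * A4) + 2 * x * (c * d - A1 * A3) + x * (c\<^sup>2 - A0 * A4) / 2
            + x\<^sup>2 * (A1 * c - A0 * A3)" and
    "k0 = (A3\<^sup>2 - A4 * d) + x * (A3 * c - A1 * A4) + x\<^sup>2 * (c\<^sup>2 - A0 * A4) / 4"
  have "centred_pencil A0 A1 A2 A3 A4 s 1 x 1 y 1 = k2 * y\<^sup>2 + k1 * y + k0" for y
    unfolding centred_pencil_def Let_def k2_def k1_def k0_def c_def d_def
    by (simp add: field_simps; algebra)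
  then have "quadratic_discriminant (\<lambda>y. centred_pencil A0 A1 A2 A3 A4 s 1 x 1 y 1)
      = k1\<^sup>2 - 4 * k2 * k0"
    by (simp add: quadratic_discriminant_quadratic)
  also have "\<dots> = weierstrass_cubic (invariant_g2 A0 A1 A2 A3 A4) (invariant_g3 A0 A1 A2 A3 A4) s
     * quartic_form A0 A1 A2 A3 A4 x 1"
    unfolding k2_def k1_def k0_def c_def d_def weierstrass_cubic_def quartic_form_def
      invariant_g2_def invariant_g3_def
    by (simp add: field_simps; algebra)
  finally show ?thesis .
qed

lemma cubic_coeffs_eq:
  fixes a0 :: complex
  assumes "\<And>m. a3 * m^3 + a2 * m\<^sup>2 + a1 * m + a0 = b3 * m^3 + b2 * m\<^sup>2 + b1 * m + b0"
  shows "a3 = b3" "a2 = b2" "a1 = b1" "a0 = b0"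
proof -
  have "poly [:a0, a1, a2, a3:] m = poly [:b0, b1, b2, b3:] m" for m
    using assms[of m] by (simp add: algebra_simps power2_eq_square power3_eq_cube)
  then have "[:a0, a1, a2, a3:] = [:b0, b1, b2, b3:]"
    by (metis poly_eq_poly_eq_iff ext)
  then show "a3 = b3" "a2 = b2" "a1 = b1" "a0 = b0"
    by simp_all
qed

text \<open>Two Weierstrass cubics that differ by an affine substitution differ by a scaling: both lack a
  quadratic term, which excludes a shift.\<close>

lemma weierstrass_forms_proportional:
  assumes "\<alpha> \<noteq> 0" "\<epsilon> \<noteq> 0"
    and "\<And>m. \<epsilon> * weierstrass_cubic G2 G3 (\<alpha> * m + d) = \<kappa> * weierstrass_cubic g2 g3 m"
  shows "d = 0" "G2 = \<alpha>\<^sup>2 * g2" "G3 = \<alpha>^3 * g3"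
proof -
  have "(4 * \<epsilon> * \<alpha>^3) * m^3 + (12 * \<epsilon> * \<alpha>\<^sup>2 * d) * m\<^sup>2 + (\<epsilon> * (12 * d\<^sup>2 - G2) * \<alpha>) * m
          + \<epsilon> * weierstrass_cubic G2 G3 d
        = (4 * \<kappa>) * m^3 + 0 * m\<^sup>2 + (- \<kappa> * g2) * m + (- \<kappa> * g3)" for m
    using assms(3)[of m] unfolding weierstrass_cubic_def by algebra
  note c = cubic_coeffs_eq[OF this]
  show d: "d = 0" using c(2) assms by simp
  have k: "\<kappa> = \<epsilon> * \<alpha>^3" using c(1) by simp
  show "G2 = \<alpha>\<^sup>2 * g2"
    using c(3) assms(1,2) unfolding d k by (simp add: power2_eq_square power3_eq_cube)
  show "G3 = \<alpha>^3 * g3"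
    using c(4) assms(1,2) unfolding d k by (simp add: weierstrass_cubic_def)
qed

section \<open>The form of the two-valued coset group\<close>

text \<open>The equation
  \<open>(m x + m y + x y + g2 / 4)\<^sup>2 = (m + x + y) (4 m x y - g3)\<close> in homogeneous coordinates. It says
  that points of the Weierstrass curve over \<open>m\<close>, \<open>x\<close>, \<open>y\<close>, with suitable signs, lie on a line:
  comparing \<open>4 (z - m) (z - x) (z - y)\<close> with \<open>4 z\<^sup>3 - g2 z - g3 - (l z + k)\<^sup>2\<close> and eliminating
  \<open>l\<close>, \<open>k\<close> gives it.\<close>

definition coset_form ::
  "complex \<Rightarrow> complex \<Rightarrow> complex \<Rightarrow> complex \<Rightarrow> complex \<Rightarrow> complex \<Rightarrow> complex \<Rightarrow> complex \<Rightarrow> complex" where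
  "coset_form g2 g3 M W X Z Y V =
     (M * X * V + M * Z * Y + W * X * Y + g2 / 4 * W * Z * V)\<^sup>2
      - (M * Z * V + W * X * V + W * Z * Y) * (4 * M * X * Y - g3 * W * Z * V)"

text \<open>Homogeneity for the weights \<open>1\<close>, \<open>2\<close>, \<open>3\<close> of the coordinates, \<open>g2\<close> and \<open>g3\<close>.\<close>

lemma coset_form_scale:
  "coset_form (\<alpha>\<^sup>2 * g2) (\<alpha>^3 * g3) (\<alpha> * M) W (\<alpha> * X) Z (\<alpha> * Y) V =
   \<alpha>^4 * coset_form g2 g3 M W X Z Y V"
  unfolding coset_form_def by (simp add: field_simps; algebra)

lemma coset_form_infinity_left: "coset_form g2 g3 1 0 X Z Y V = (Y * Z - V * X)\<^sup>2"
  unfolding coset_form_def by simp algebra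

lemma coset_form_infinity_right: "coset_form g2 g3 M W 1 0 Y V = (Y * W - V * M)\<^sup>2"
  unfolding coset_form_def by simp algebra

text \<open>The half-slopes \<open>w1\<close>, \<open>w2\<close> of the two chords, together with \<open>m\<close> and \<open>x\<close>, parametrise all the
  data: \<open>n\<close>, \<open>u\<close>, \<open>g2\<close> and \<open>g3\<close> are polynomials in them, and the factorisation
  becomes a polynomial identity.\<close>

lemma coset_form_chord:
  assumes "m \<noteq> x" "n\<^sup>2 = weierstrass_cubic g2 g3 m" "u\<^sup>2 = weierstrass_cubic g2 g3 x"
  shows "coset_form g2 g3 m 1 x 1 Y V = (m - x)\<^sup>2 *
    ((Y - V * (- m - x + ((n - u) / (2 * (m - x)))\<^sup>2)) * (Y - V * (- m - x + ((n + u) / (2 * (m - x)))\<^sup>2)))"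
proof -
  define D where "D = m - x"
  have D: "D \<noteq> 0" using assms(1) by (simp add: D_def)
  define w1 w2 where "w1 = (n - u) / (2 * D)" and "w2 = (n + u) / (2 * D)"
  have n: "n = D * (w1 + w2)" and u: "u = D * (w2 - w1)"
    using D unfolding w1_def w2_def by (simp_all add: field_simps)
  have g3: "g3 = 4 * m^3 - g2 * m - n\<^sup>2"
    using assms(2) by (simp add: weierstrass_cubic_def)
  have "D * (g2 - (4 * (m\<^sup>2 + m * x + x\<^sup>2) - 4 * D * w1 * w2)) = 0"
    using assms(2,3) unfolding n u weierstrass_cubic_def D_def by algebra
  then have g2: "g2 = 4 * (m\<^sup>2 + m * x + x\<^sup>2) - 4 * D * w1 * w2"
    using D by simp
  show ?thesis
    unfolding D_def[symmetric] w1_def[symmetric] w2_def[symmetric]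
    unfolding coset_form_def g3 n g2 unfolding D_def by (simp add: field_simps; algebra)
qed

text \<open>On the diagonal one root escapes to infinity, as \<open>A - A\<close> is the unit. If moreover \<open>A\<close> has
  order two, the coefficient of \<open>Y\<close> vanishes as well and both roots are at infinity, provided the
  remaining coefficient \<open>(12 m\<^sup>2 - g2)\<^sup>2 / 16\<close> is not zero.\<close>

lemma coset_form_diagonal:
  "coset_form g2 g3 m 1 m 1 Y V =
    V * (((12 * m\<^sup>2 - g2)\<^sup>2 / 16 - 2 * m * weierstrass_cubic g2 g3 m) * V - weierstrass_cubic g2 g3 m * Y)"
  unfolding coset_form_def weierstrass_cubic_def by (simp add: field_simps; algebra)

text \<open>The cases follow the case distinctions of the group law: unit, chord, tangent, and a point of
  order two added to itself. Simplicity of the zeros of the cubic excludes in the last case that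
  the form is identically zero.\<close>

lemma coset_form_roots:
  assumes simple: "\<And>m. weierstrass_cubic g2 g3 m = 0 \<Longrightarrow> 12 * m\<^sup>2 \<noteq> g2"
    and "A \<in> weierstrass_curve g2 g3" "B \<in> weierstrass_curve g2 g3"
  defines "m \<equiv> curve_class A" and "x \<equiv> curve_class B"
  shows "has_cp1_roots (coset_form g2 g3 (cp1_num m) (cp1_den m) (cp1_num x) (cp1_den x))
           (coset_product g2 A B)"
proof (cases A)
  case None
  have "curve_class (curve_neg B) = curve_class B"
    by (cases B) (auto simp: curve_class_def)
  then show ?thesis
    unfolding has_cp1_roots_def m_def x_def None coset_product_def
    by (intro exI[of _ 1]) (simp add: curve_class_def coset_form_infinity_left power2_eq_square)
next
  case A: (Some a)
  obtain m' n where a: "a = (m', n)" by fastforce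
  have n: "n\<^sup>2 = weierstrass_cubic g2 g3 m'"
    using assms(2) unfolding A a weierstrass_curve_def by auto
  show ?thesis
  proof (cases B)
    case None
    then show ?thesis
      unfolding has_cp1_roots_def m_def x_def A a coset_product_def
      by (intro exI[of _ 1]) (simp add: curve_class_def coset_form_infinity_right power2_eq_square)
  next
    case B: (Some b)
    obtain x' u where b: "b = (x', u)" by fastforce
    have u: "u\<^sup>2 = weierstrass_cubic g2 g3 x'"
      using assms(3) unfolding B b weierstrass_curve_def by auto
    show ?thesis
    proof (cases "m' = x'")
      case False
      have half: "- m' - x' + (l / (2 * (m' - x')))\<^sup>2 = (l / (m' - x'))\<^sup>2 / 4 - m' - x'" for l
        unfolding power_divide power_mult_distrib by simp
      have "coset_product g2 A B =
          {# Some (- m' - x' + ((n - u) / (2 * (m' - x')))\<^sup>2),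
             Some (- m' - x' + ((n + u) / (2 * (m' - x')))\<^sup>2) #}"
        using False unfolding half A a B b coset_product_def
        by (simp add: curve_class_def Let_def)
      then show ?thesis
        unfolding has_cp1_roots_def m_def x_def A a B b
        using False
        by (intro exI[of _ "(m' - x')\<^sup>2"])
          (simp add: curve_class_def coset_form_chord[OF False n u])
    next
      case True
      show ?thesis
      proof (cases "n = 0")
        case n0: True
        then have w: "weierstrass_cubic g2 g3 m' = 0" using n by simp
        have u0: "u = 0" using u w True by simp
        have "12 * m'\<^sup>2 - g2 \<noteq> 0" using simple[OF w] by simp
        then show ?thesis
          unfolding has_cp1_roots_def m_def x_def A a B b coset_product_def True[symmetric] n0 u0
          by (intro exI[of _ "(12 * m'\<^sup>2 - g2)\<^sup>2 / 16"])
            (simp add: curve_class_def coset_form_diagonal w)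
      next
        case n0: False
        define y where "y = ((12 * m'\<^sup>2 - g2) / (2 * n))\<^sup>2 / 4 - m' - m'"
        have f: "coset_form g2 g3 m' 1 m' 1 Y V = n\<^sup>2 * ((- V) * (Y - V * y))" for Y V
          unfolding coset_form_diagonal n[symmetric] y_def using n0
          by (simp add: field_simps power2_eq_square)
        have "u\<^sup>2 = n\<^sup>2" using n u True by simp
        then have "u = n \<or> u = - n" by (rule power2_eq_iff[THEN iffD1])
        then have "coset_product g2 A B = {#None, Some y#}"
          using n0 unfolding A a B b coset_product_def True[symmetric] y_def
          by (auto simp: curve_class_def Let_def add_mset_commute)
        then show ?thesis
          unfolding has_cp1_roots_def m_def x_def A a B b True[symmetric]
          using n0 by (intro exI[of _ "n\<^sup>2"]) (simp add: curve_class_def f)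
      qed
    qed
  qed
qed

lemma proots_scaled_coset_form:
  assumes "C \<noteq> 0" "m \<noteq> x" "n\<^sup>2 = weierstrass_cubic g2 g3 m" "u\<^sup>2 = weierstrass_cubic g2 g3 x"
  shows "proots (poly_of_fun (\<lambda>y. C * coset_form g2 g3 m 1 x 1 y 1)) =
    {# - m - x + ((n - u) / (2 * (m - x)))\<^sup>2, - m - x + ((n + u) / (2 * (m - x)))\<^sup>2 #}"
proof -
  define y1 y2 where "y1 = - m - x + ((n - u) / (2 * (m - x)))\<^sup>2"
    and "y2 = - m - x + ((n + u) / (2 * (m - x)))\<^sup>2"
  have "poly_of_fun (\<lambda>y. C * coset_form g2 g3 m 1 x 1 y 1)
      = smult (C * (m - x)\<^sup>2) ([:- y1, 1:] * [:- y2, 1:])"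
    by (rule poly_of_fun_eqI)
      (simp add: coset_form_chord[OF assms(2-4), folded y1_def y2_def] algebra_simps)
  also have "proots \<dots> = proots ([:- y1, 1:] * [:- y2, 1:])"
    using assms(1,2) by (intro proots_smult) simp
  also have "\<dots> = {# y1, y2 #}"
    by (subst proots_mult) simp_all
  finally show ?thesis
    unfolding y1_def y2_def .
qed

section \<open>Reduction of the pencil to the form of the coset group\<close>

text \<open>Translations act on the block of the matrix by congruence with a unipotent matrix, which also
  preserves the part multiplied by \<open>s\<close>. So the centred parameter does not change while
  the quartic is translated.\<close>

lemma centred_pencil_translate:
  "centred_pencil A0 A1 A2 A3 A4 S W (X1 + e * Z1) Z1 (X2 + e * Z2) Z2 =
   centred_pencil A0 (A1 + e * A0) (A2 + 2 * e * A1 + e\<^sup>2 * A0)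
     (A3 + 3 * e * A2 + 3 * e\<^sup>2 * A1 + e^3 * A0) (quartic_form A0 A1 A2 A3 A4 e 1)
     S W X1 Z1 X2 Z2"
  unfolding centred_pencil_def quartic_form_def Let_def by (simp add: field_simps; algebra)

lemma quartic_form_translate:
  "quartic_form A0 A1 A2 A3 A4 (X + e * Z) Z =
   quartic_form A0 (A1 + e * A0) (A2 + 2 * e * A1 + e\<^sup>2 * A0)
     (A3 + 3 * e * A2 + 3 * e\<^sup>2 * A1 + e^3 * A0) (quartic_form A0 A1 A2 A3 A4 e 1) X Z"
  unfolding quartic_form_def power_one by algebra

lemma invariant_g2_translate:
  "invariant_g2 A0 (A1 + e * A0) (A2 + 2 * e * A1 + e\<^sup>2 * A0)
     (A3 + 3 * e * A2 + 3 * e\<^sup>2 * A1 + e^3 * A0) (quartic_form A0 A1 A2 A3 A4 e 1) =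
   invariant_g2 A0 A1 A2 A3 A4"
  unfolding quartic_form_def invariant_g2_def power_one by algebra

lemma invariant_g3_translate:
  "invariant_g3 A0 (A1 + e * A0) (A2 + 2 * e * A1 + e\<^sup>2 * A0)
     (A3 + 3 * e * A2 + 3 * e\<^sup>2 * A1 + e^3 * A0) (quartic_form A0 A1 A2 A3 A4 e 1) =
   invariant_g3 A0 A1 A2 A3 A4"
  unfolding quartic_form_def invariant_g3_def power_one by algebra

text \<open>For a quartic with the zero \<open>0\<close>, the substitution \<open>x = A3 / (z - A2 / 2)\<close> sends \<open>z = \<infinity>\<close>
  to this zero; the shift by \<open>A2 / 2\<close> removes the quadratic term of the resulting cubic. This is
  the classical substitution that turns \<open>u\<^sup>2 = P(x)\<close> into a Weierstrass equation, and the pencil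
  polynomial itself becomes the form of the coset group.\<close>

lemma centred_pencil_invert:
  "centred_pencil A0 A1 A2 A3 0 S W (A3 * Z) (X - A2 / 2 * Z) (A3 * V) (Y - A2 / 2 * V) =
   A3\<^sup>2 * coset_form (invariant_g2 A0 A1 A2 A3 0) (invariant_g3 A0 A1 A2 A3 0) S W X Z Y V"
  unfolding centred_pencil_def coset_form_def invariant_g2_def invariant_g3_def Let_def
  by (simp add: field_simps; algebra)

lemma quartic_form_invert:
  "quartic_form A0 A1 A2 A3 0 (A3 * Z) (X - A2 / 2 * Z) =
   A3\<^sup>2 * Z * (4 * X^3 - invariant_g2 A0 A1 A2 A3 0 * X * Z\<^sup>2 - invariant_g3 A0 A1 A2 A3 0 * Z^3)"
  unfolding quartic_form_def invariant_g2_def invariant_g3_def 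
  by (simp add: field_simps; algebra)

text \<open>Translation of the zero \<open>e\<close> to the origin, inversion, and the rescaling by \<open>\<alpha>\<close> that
  matches the invariants of the quartic with the given \<open>g2\<close>, \<open>g3\<close>. The same substitution turns
  the quartic into the Weierstrass cubic, and the same \<open>\<alpha>\<close> rescales the parameter of the pencil.\<close>

lemma centred_pencil_normal_form:
  fixes A0 A1 A2 A3 A4 e \<alpha> g2 g3 :: complex
  defines "B2 \<equiv> A2 + 2 * e * A1 + e\<^sup>2 * A0"
    and "B3 \<equiv> A3 + 3 * e * A2 + 3 * e\<^sup>2 * A1 + e^3 * A0"
  assumes root: "quartic_form A0 A1 A2 A3 A4 e 1 = 0"
    and g2: "invariant_g2 A0 A1 A2 A3 A4 = \<alpha>\<^sup>2 * g2"
    and g3: "invariant_g3 A0 A1 A2 A3 A4 = \<alpha>^3 * g3"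
  defines "p \<equiv> \<alpha> * e" and "q \<equiv> B3 - e * (B2 / 2)" and "r \<equiv> \<alpha>" and "t \<equiv> - (B2 / 2)"
  shows "centred_pencil A0 A1 A2 A3 A4 (\<alpha> * M) W (p * X + q * Z) (r * X + t * Z)
           (p * Y + q * V) (r * Y + t * V) = B3\<^sup>2 * \<alpha>^4 * coset_form g2 g3 M W X Z Y V"
    and "quartic_form A0 A1 A2 A3 A4 (p * z + q) (r * z + t)
           = B3\<^sup>2 * \<alpha>^3 * weierstrass_cubic g2 g3 z"
proof -
  define B1 where "B1 = A1 + e * A0"
  have g2': "invariant_g2 A0 B1 B2 B3 0 = \<alpha>\<^sup>2 * g2"
    using invariant_g2_translate[of A0 A1 e A2 A3 A4] g2
    by (simp add: root B1_def B2_def B3_def)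
  have g3': "invariant_g3 A0 B1 B2 B3 0 = \<alpha>^3 * g3"
    using invariant_g3_translate[of A0 A1 e A2 A3 A4] g3
    by (simp add: root B1_def B2_def B3_def)
  have x: "p * X + q * Z = B3 * Z + e * (\<alpha> * X - B2 / 2 * Z)"
    and z: "r * X + t * Z = \<alpha> * X - B2 / 2 * Z" for X Z
    by (simp_all add: p_def q_def r_def t_def algebra_simps)
  have translate: "centred_pencil A0 A1 A2 A3 A4 S W (X1 + e * Z1) Z1 (X2 + e * Z2) Z2 =
      centred_pencil A0 B1 B2 B3 0 S W X1 Z1 X2 Z2" for S X1 Z1 X2 Z2
    unfolding centred_pencil_translate root B1_def B2_def B3_def ..
  show "centred_pencil A0 A1 A2 A3 A4 (\<alpha> * M) W (p * X + q * Z) (r * X + t * Z)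
      (p * Y + q * V) (r * Y + t * V) = B3\<^sup>2 * \<alpha>^4 * coset_form g2 g3 M W X Z Y V"
    unfolding x z translate centred_pencil_invert g2' g3' coset_form_scale by simp
  have "quartic_form A0 A1 A2 A3 A4 (X + e * Z) Z = quartic_form A0 B1 B2 B3 0 X Z" for X Z
    unfolding quartic_form_translate root B1_def B2_def B3_def ..
  then have "quartic_form A0 A1 A2 A3 A4 (p * z + q) (r * z + t)
      = quartic_form A0 B1 B2 B3 0 (B3 * 1) (\<alpha> * z - B2 / 2 * 1)"
    using x[of z 1] z[of z 1] by simp
  also have "\<dots> = B3\<^sup>2 * \<alpha>^3 * weierstrass_cubic g2 g3 z"
    unfolding quartic_form_invert g2' g3' weierstrass_cubic_def power_one by algebra
  finally show "quartic_form A0 A1 A2 A3 A4 (p * z + q) (r * z + t)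
      = B3\<^sup>2 * \<alpha>^3 * weierstrass_cubic g2 g3 z" .
qed

section \<open>Zeros of the quartic and of the cubic\<close>

lemma quartic_form_dehomogenize:
  "quartic_form A0 A1 A2 A3 A4 (x * Z) Z = Z^4 * quartic_form A0 A1 A2 A3 A4 x 1"
  unfolding quartic_form_def power_one by algebra

text \<open>As \<open>\<infinity>\<close> goes to the zero \<open>p / r\<close> of the quartic, the other zeros correspond to finite
  zeros of its pullback, which is \<open>f\<close> up to a factor. A zero of \<open>f\<close> cannot be sent to \<open>\<infinity>\<close>, because a quartic with \<open>A0 \<noteq> 0\<close> does not vanish there.\<close>

lemma moebius_cp1_image_roots:
  assumes r: "r \<noteq> 0" and det: "p * t - q * r \<noteq> 0" and C: "C \<noteq> 0" and A0: "A0 \<noteq> 0"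
    and pb: "\<And>z. quartic_form A0 A1 A2 A3 A4 (p * z + q) (r * z + t) = C * f z"
    and e: "quartic_form A0 A1 A2 A3 A4 (p / r) 1 = 0"
  shows "moebius_cp1 p q r t ` insert None (Some ` {z. f z = 0}) =
         Some ` {x. quartic_form A0 A1 A2 A3 A4 x 1 = 0}" (is "?L = ?R")
proof
  show "?L \<subseteq> ?R"
  proof -
    have "r * z + t \<noteq> 0 \<and> quartic_form A0 A1 A2 A3 A4 (moebius p q r t z) 1 = 0"
      if z: "f z = 0" for z
    proof
      show nz: "r * z + t \<noteq> 0"
      proof
        assume d: "r * z + t = 0"
        then have t: "t = - r * z" by algebra
        have "p * z + q \<noteq> 0"
        proof
          assume "p * z + q = 0"
          then have "q = - p * z" by algebra
          then show False using det unfolding t by simp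
        qed
        then show False
          using pb[of z] z A0 unfolding d quartic_form_def by simp
      qed
      have "p * z + q = moebius p q r t z * (r * z + t)"
        using nz by (simp add: moebius_def)
      then show "quartic_form A0 A1 A2 A3 A4 (moebius p q r t z) 1 = 0"
        using pb[of z] z nz by (simp add: quartic_form_dehomogenize)
    qed
    then show ?thesis
      using r e by auto
  qed
next
  show "?R \<subseteq> ?L"
  proof clarify
    fix x assume x: "quartic_form A0 A1 A2 A3 A4 x 1 = 0"
    show "Some x \<in> ?L"
    proof (cases "x = p / r")
      case True
      then have "Some x = moebius_cp1 p q r t None" using r by simp
      then show ?thesis by blast
    next
      case False
      then have d: "p - r * x \<noteq> 0" using r by (auto simp: field_simps)
      define z where "z = (t * x - q) / (p - r * x)"
      define D where "D = (p * t - q * r) / (p - r * x)"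
      have D: "D \<noteq> 0" "r * z + t = D" "p * z + q = x * D"
        using d det unfolding z_def D_def by (simp_all add: field_simps)
      have "f z = 0"
        using pb[of z] x C unfolding D by (simp add: quartic_form_dehomogenize)
      moreover have "Some x = moebius_cp1 p q r t (Some z)"
        using D by (simp add: moebius_def)
      ultimately show ?thesis by blast
    qed
  qed
qed

lemma poly_square_eq_cases:
  fixes p q :: "'a :: {idom, ring_char_0} poly"
  assumes "\<And>x. (poly p x)\<^sup>2 = (poly q x)\<^sup>2"
  shows "p = q \<or> p = - q"
proof -
  have "poly (p\<^sup>2) x = poly (q\<^sup>2) x" for x
    using assms by (simp add: poly_power)
  then have "p\<^sup>2 = q\<^sup>2"
    by (metis poly_eq_poly_eq_iff ext)
  then show ?thesis
    by (simp add: power2_eq_iff)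
qed

text \<open>After division by the linear factor of a multiple zero, the quotient would have the same zeros
  and a degree too small for their number.\<close>

lemma simple_root_if_all_distinct:
  fixes p :: "'a :: idom poly"
  assumes "card {z. poly p z = 0} = degree p" "degree p > 0" "poly p e = 0"
  shows "poly (pderiv p) e \<noteq> 0"
proof
  assume d: "poly (pderiv p) e = 0"
  from assms(3) obtain q where q: "p = [:- e, 1:] * q"
    by (auto simp: poly_eq_0_iff_dvd elim: dvdE)
  have "q \<noteq> 0"
    using q assms(2) by auto
  have "poly q e = 0"
    using d unfolding q pderiv_mult by (simp add: pderiv_pCons del: mult_pCons_left)
  then have "{z. poly p z = 0} = {z. poly q z = 0}"
    unfolding q by auto
  then have "degree p \<le> degree q"
    using card_poly_roots_bound[OF \<open>q \<noteq> 0\<close>] assms(1) by simp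
  moreover have "degree p = Suc (degree q)"
    using \<open>q \<noteq> 0\<close> unfolding q by (subst degree_mult_eq) auto
  ultimately show False by simp
qed

lemma weierstrass_cubic_eq_poly: "weierstrass_cubic g2 g3 z = poly [:- g3, - g2, 0, 4:] z"
  by (simp add: weierstrass_cubic_def algebra_simps power3_eq_cube)

lemma finite_weierstrass_roots: "finite {z. weierstrass_cubic g2 g3 z = 0}"
  unfolding weierstrass_cubic_eq_poly by (rule poly_roots_finite) simp

lemma weierstrass_cubic_simple_root:
  assumes "card {z. weierstrass_cubic g2 g3 z = 0} \<ge> 3" "weierstrass_cubic g2 g3 m = 0"
  shows "12 * m\<^sup>2 \<noteq> g2"
proof -
  let ?w = "[:- g3, - g2, 0, 4:]"
  have "card {z. poly ?w z = 0} = degree ?w"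
    using card_poly_roots_bound[of ?w] assms(1) unfolding weierstrass_cubic_eq_poly by simp
  then have "poly (pderiv ?w) m \<noteq> 0"
    using assms(2) unfolding weierstrass_cubic_eq_poly
    by (intro simple_root_if_all_distinct) simp_all
  then show ?thesis
    by (auto simp: pderiv_pCons algebra_simps power2_eq_square)
qed

section \<open>The coset group defined by the pencil\<close>

theorem theorem4:
  fixes a :: "nat \<Rightarrow> complex"
    and P J :: "complex poly"
    and g2 g3 :: complex
  assumes "\<And>x1 x2. quadratic_discriminant (\<lambda>s. pencil a s x1 x2) = poly P x1 * poly P x2"
    and "\<And>s x1. quadratic_discriminant (\<lambda>x2. pencil a s x1 x2) = poly J s * poly P x1"
    and "degree P = 4"
    and "degree J = 3"
    and "card {z. poly P z = 0} = 4"
    and "weierstrass_form_of J g2 g3"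
  shows "\<exists>p q r t \<alpha> \<beta>.
     p * t - q * r \<noteq> 0 \<and> \<alpha> \<noteq> 0 \<and>
     moebius_cp1 p q r t ` insert None (Some ` {e. weierstrass_cubic g2 g3 e = 0})
       = Some ` {z. poly P z = 0} \<and>
     defines_coset_group g2 g3 (pencil_pullback a \<alpha> \<beta> p q r t) \<and>
     (\<forall>m x n u. m \<noteq> x \<longrightarrow> n\<^sup>2 = weierstrass_cubic g2 g3 m \<longrightarrow> u\<^sup>2 = weierstrass_cubic g2 g3 x \<longrightarrow>
        proots (poly_of_fun (\<lambda>y. pencil_pullback a \<alpha> \<beta> p q r t m 1 x 1 y 1))
          = {# - m - x + ((n - u) / (2 * (m - x)))\<^sup>2, - m - x + ((n + u) / (2 * (m - x)))\<^sup>2 #})"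
proof -
  define A0 A1 A2 A3 A4 where A: "A0 = a 0" "A1 = - a 1" "A2 = (2 * a 2 + a 5) / 3"
    "A3 = - a 3" "A4 = a 4"
  define \<delta> where "\<delta> = a 2 - A2"
  define Q where "Q = [:A4, 4 * A3, 6 * A2, 4 * A1, A0:]"
  have hom: "pencil_hom a S W X1 Z1 X2 Z2 =
      centred_pencil A0 A1 A2 A3 A4 (S + \<delta> * W) W X1 Z1 X2 Z2" for S W X1 Z1 X2 Z2
    unfolding A \<delta>_def by (rule pencil_hom_eq_centred)
  have pencil: "pencil a s x1 x2 = centred_pencil A0 A1 A2 A3 A4 (s + \<delta>) 1 x1 1 x2 1"
    for s x1 x2
    using hom[of s 1 x1 1 x2 1] by (simp add: pencil_hom_one)
  have Q: "quartic_form A0 A1 A2 A3 A4 x 1 = poly Q x" for x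
    unfolding Q_def quartic_form_def
    by (simp add: algebra_simps power2_eq_square power3_eq_cube power4_eq_xxxx)

  \<comment> \<open>On the diagonal the first discriminant is \<open>P(x)\<^sup>2\<close> by hypothesis and \<open>Q(x)\<^sup>2\<close> by computation.\<close>
  have "(poly P x)\<^sup>2 = (poly Q x)\<^sup>2" for x
  proof -
    have "pencil a s x x = 0 * s\<^sup>2 + (- poly Q x) * s
        + (centred_pencil A0 A1 A2 A3 A4 0 1 x 1 x 1 - poly Q x * \<delta>)" for s
      unfolding pencil
      by (subst centred_pencil_quadratic_s) (simp add: Q algebra_simps)
    then have "quadratic_discriminant (\<lambda>s. pencil a s x x) = (poly Q x)\<^sup>2"
      by (simp only: quadratic_discriminant_quadratic) simp
    then show ?thesis
      using assms(1)[of x x] by (simp add: power2_eq_square)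
  qed
  then have "P = Q \<or> P = - Q"
    by (rule poly_square_eq_cases)
  \<comment> \<open>Only the squares have been compared; the sign \<open>\<epsilon>\<close> will affect \<open>J\<close> but not its invariants.\<close>
  then obtain \<epsilon> where \<epsilon>: "\<epsilon> \<noteq> 0" "\<And>x. poly Q x = \<epsilon> * poly P x" and deg: "degree Q = 4"
    using assms(3) by (metis degree_minus minus_minus mult_1 mult_minus1 neg_equal_0_iff_equal
        poly_minus zero_neq_one)
  have zeros: "poly Q z = 0 \<longleftrightarrow> poly P z = 0" for z
    using \<epsilon> by simp
  have A0: "A0 \<noteq> 0"
    using deg unfolding Q_def by (auto split: if_splits)

  have "poly P \<noteq> poly 0"
    using assms(3) by (metis degree_0 poly_eq_poly_eq_iff zero_neq_numeral)
  then obtain x0 where x0: "poly P x0 \<noteq> 0"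
    by (auto simp: fun_eq_iff)
  have J: "poly J s =
      \<epsilon> * weierstrass_cubic (invariant_g2 A0 A1 A2 A3 A4) (invariant_g3 A0 A1 A2 A3 A4) (s + \<delta>)"
    for s
    using assms(2)[of s x0] x0 by (simp add: pencil centred_pencil_discriminant Q \<epsilon>(2) mult.commute)
  from assms(6) obtain \<alpha> \<beta> \<mu> where \<alpha>: "\<alpha> \<noteq> 0"
    and J': "\<And>m. poly J (\<alpha> * m + \<beta>) = \<mu>\<^sup>2 * weierstrass_cubic g2 g3 m"
    unfolding weierstrass_form_of_def by blast
  have "\<epsilon> * weierstrass_cubic (invariant_g2 A0 A1 A2 A3 A4) (invariant_g3 A0 A1 A2 A3 A4)
      (\<alpha> * m + (\<beta> + \<delta>)) = \<mu>\<^sup>2 * weierstrass_cubic g2 g3 m" for m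
    using J'[of m] unfolding J by (simp add: add.assoc)
  \<comment> \<open>The shift \<open>\<beta>\<close> given with the Weierstrass form undoes the centring, and \<open>\<alpha>\<close> relates the invariants.\<close>
  note inv = weierstrass_forms_proportional[OF \<alpha> \<epsilon>(1) this]

  have "{z. poly P z = 0} \<noteq> {}"
    using assms(5) by (metis card.empty zero_neq_numeral)
  then obtain e where "poly Q e = 0"
    using zeros by auto
  then have e: "quartic_form A0 A1 A2 A3 A4 e 1 = 0"
    by (simp add: Q)
  define B2 B3 where "B2 = A2 + 2 * e * A1 + e\<^sup>2 * A0"
    and "B3 = A3 + 3 * e * A2 + 3 * e\<^sup>2 * A1 + e^3 * A0"
  \<comment> \<open>The determinant of the fractional-linear map will be \<open>- \<alpha> B3\<close>, and \<open>4 B3 = Q'(e)\<close>.\<close>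
  have "poly (pderiv Q) e \<noteq> 0"
    using assms(5) deg \<open>poly Q e = 0\<close> by (intro simple_root_if_all_distinct) (simp_all add: zeros)
  moreover have "poly (pderiv Q) e = 4 * B3"
    by (simp add: Q_def B3_def pderiv_pCons algebra_simps power2_eq_square power3_eq_cube)
  ultimately have B3: "B3 \<noteq> 0" by simp

  \<comment> \<open>This is \<open>x = e + (Q'(e) / 4) / (\<alpha> z - Q''(e) / 24)\<close>.\<close>
  define p q r t where "p = \<alpha> * e" and "q = B3 - e * (B2 / 2)" and "r = \<alpha>" and "t = - (B2 / 2)"
  note nf = centred_pencil_normal_form[OF e inv(2,3),
      folded B2_def B3_def, folded p_def q_def t_def, folded r_def]
  have r: "r \<noteq> 0" using \<alpha> by (simp add: r_def)
  have det: "p * t - q * r \<noteq> 0"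
    using \<alpha> B3 by (simp add: p_def q_def r_def t_def algebra_simps)
  have image: "moebius_cp1 p q r t ` insert None (Some ` {z. weierstrass_cubic g2 g3 z = 0}) =
      Some ` {z. poly P z = 0}"
  proof -
    have "B3\<^sup>2 * r^3 \<noteq> 0" using B3 r by simp
    from moebius_cp1_image_roots[OF r det this A0 nf(2)] show ?thesis
      using e \<alpha> by (simp add: p_def r_def Q zeros)
  qed
  \<comment> \<open>The bijection of zeros transports the four distinct zeros of \<open>P\<close> to three distinct zeros of the cubic.\<close>
  have simple: "12 * m\<^sup>2 \<noteq> g2" if "weierstrass_cubic g2 g3 m = 0" for m
  proof -
    let ?Z = "{z. weierstrass_cubic g2 g3 z = 0}"
    have "4 = card (Some ` {z. poly P z = 0})"
      using assms(5) by (simp add: card_image)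
    also have "\<dots> \<le> card (insert None (Some ` ?Z))"
      unfolding image[symmetric] by (intro card_image_le) (simp add: finite_weierstrass_roots)
    also have "\<dots> = Suc (card ?Z)"
      by (simp add: card_image finite_weierstrass_roots)
    finally have "3 \<le> card ?Z" by simp
    then show ?thesis using weierstrass_cubic_simple_root that by blast
  qed
  define C where "C = B3\<^sup>2 * r^4"
  have C: "C \<noteq> 0" using B3 r by (simp add: C_def)
  have pullback: "pencil_pullback a \<alpha> \<beta> p q r t M W X Z Y V = C * coset_form g2 g3 M W X Z Y V"
    for M W X Z Y V
  proof -
    have "\<alpha> * M + \<beta> * W + \<delta> * W = r * M"
      using inv(1) unfolding r_def by algebra
    then show ?thesis
      unfolding pencil_pullback_def hom C_def by (simp add: nf(1))
  qed
  have "defines_coset_group g2 g3 (pencil_pullback a \<alpha> \<beta> p q r t)"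
    unfolding defines_coset_group_def Let_def
  proof (intro ballI)
    fix A B assume "A \<in> weierstrass_curve g2 g3" "B \<in> weierstrass_curve g2 g3"
    from coset_form_roots[OF simple this] obtain k where "k \<noteq> 0"
      and "\<And>Y V. coset_form g2 g3 (cp1_num (curve_class A)) (cp1_den (curve_class A))
             (cp1_num (curve_class B)) (cp1_den (curve_class B)) Y V
           = k * (\<Prod>y\<in>#coset_product g2 A B. Y * cp1_den y - V * cp1_num y)"
      unfolding has_cp1_roots_def by blast
    then show "has_cp1_roots (pencil_pullback a \<alpha> \<beta> p q r t (cp1_num (curve_class A))
        (cp1_den (curve_class A)) (cp1_num (curve_class B)) (cp1_den (curve_class B)))
        (coset_product g2 A B)"
      unfolding has_cp1_roots_def pullback using C by (intro exI[of _ "C * k"]) simp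
  qed
  moreover have "\<forall>m x n u. m \<noteq> x \<longrightarrow> n\<^sup>2 = weierstrass_cubic g2 g3 m \<longrightarrow>
      u\<^sup>2 = weierstrass_cubic g2 g3 x \<longrightarrow>
      proots (poly_of_fun (\<lambda>y. pencil_pullback a \<alpha> \<beta> p q r t m 1 x 1 y 1)) =
        {# - m - x + ((n - u) / (2 * (m - x)))\<^sup>2, - m - x + ((n + u) / (2 * (m - x)))\<^sup>2 #}"
    unfolding pullback using proots_scaled_coset_form[OF C] by blast
  ultimately show ?thesis
    using det \<alpha> image by blast
qed

end
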